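(* Let $t_0$ be an initial seed and $\Delta^+$ the set of seeds obtained from it by finite sequences of mutations. For every $t\in\Delta^+$ let a subset $\mathcal S(t)=\{S_m(t)\mid m\in\mathbb{Z}^I\}\subset\mathcal{LP}^A(t)$ be given, where $S_m(t)=A(t)^m\cdot F_m(t)|_{X(t)^n\mapsto A(t)^{p^*n}}$ for chosen polynomials $F_m(t)=\sum_{n\in\mathbb{N}^{I_{\mathrm{uf}}}}c_n(m;t)X(t)^n$ with $c_n(m;t)\in\Bbbk$, $c_0(m;t)=1$. Assume: (i) for all $t,t'\in\Delta^+$ with $t'=\boldsymbol\mu t$, one has $\boldsymbol\mu^*\mathcal S(t')=\mathcal S(t)$; (ii) if $m'=m+u$ with $u\in M^\circ_{\mathrm f}(t)$, then $F_{m'}(t)=F_m(t)$; and if $t,t'\in\Delta^+$ are similar up to $\sigma$ and $\mathrm{pr}_{I_{\mathrm{uf}}}m'=\sigma\,\mathrm{pr}_{I_{\mathrm{uf}}}m$ for $m,m'\in\mathbb{Z}^I$, then $c_{\sigma n}(m';t')=c_n(m;t)$ for all $n$. Let $t\in\Delta^+$ and let $\mathrm{tw}^A$ be any twist endomorphism on the (quantum) upper cluster algebra $\mathcal U^A=\mathcal U^A(t)$. Then: (1) $\mathrm{tw}^A\mathcal S(t)\subset\mathcal S(t)$. (2) If $\mathrm{tw}^A$ is a twist automorphism, then $\mathrm{tw}^A\mathcal S(t)=\mathcal S(t)$.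
   Context: Seeds. Fix a finite set $I=I_{\mathrm{uf}}\sqcup I_{\mathrm f}$ (unfrozen, frozen) and integers $d_i>0$. A seed $t$ consists of indeterminates $(A_i)_{i\in I}$, $(X_i)_{i\in I}$ and an integer matrix $B(t)=(b_{ij})_{i,j\in I}$ with $\frac1{d_i}b_{ij}=-\frac1{d_j}b_{ji}$. $N(t)=\mathbb{Z}^I$ has basis $\mathbf e_i$, $\mathbf f_i=\frac1{d_i}\mathbf e_i^*$, $M^\circ(t)=\bigoplus_i\mathbb{Z}\mathbf f_i\simeq\mathbb{Z}^I$, $M^\circ_{\mathrm f}(t)=\bigoplus_{j\in I_{\mathrm f}}\mathbb{Z}\mathbf f_j$. $p^*:N(t)\to M^\circ(t)$, $p^*\mathbf e_j=\sum_ib_{ij}\mathbf f_i$; $\mathbb{N}^{I_{\mathrm{uf}}}\subset N(t)$ via $\mathbf e_k$. A compatible Poisson structure is a $\mathbb{Q}$-valued skew-symmetric form $\lambda$ on $M^\circ(t)$ with $\lambda(\mathbf f_i,p^*\mathbf e_k)=-\delta_{ik}\frac1{d_k}$ for $i\in I$, $k\in I_{\mathrm{uf}}$. $\mathrm{pr}_{I_{\mathrm{uf}}}:\mathbb{Z}^I\to\mathbb{Z}^{I_{\mathrm{uf}}}$ is the projection; for a permutation $\sigma$ of $I_{\mathrm{uf}}$ and a vector $w$, $(\sigma w)_{\sigma k}=w_k$. Objects of $t'$ carry a prime. Base ring. Classical case: $\Bbbk=\mathbb{Z}$, $v=1$. Quantum case: $\Bbbk=\mathbb{Z}[v^{\pm1/d'}]$,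 $d'$ sufficiently divisible, with a chosen compatible Poisson structure $\lambda$ on $t_0$. $\mathcal{LP}^A(t)=\Bbbk[A_i^{\pm1}]$ has product $A^m*A^{m'}=v^{\lambda(m,m')}A^{m+m'}$ (usual product if $v=1$); $\cdot$ is the commutative product; $\mathcal F^A(t)$ is the (skew-)field of fractions. Mutation. For $k\in I_{\mathrm{uf}}$, $\mu_kt$ has matrix $b'_{ij}=-b_{ij}$ if $k\in\{i,j\}$, $b'_{ij}=b_{ij}+b_{ik}[b_{kj}]_++[-b_{ik}]_+b_{kj}$ otherwise ($[x]_+=\max(x,0)$); $\lambda$ is transported by the isomorphism $M^\circ(\mu_kt)\to M^\circ(t)$, $\mathbf f'_i\mapsto\mathbf f_i$ ($i\ne k$), $\mathbf f'_k\mapsto-\mathbf f_k+\sum_j[-b_{jk}]_+\mathbf f_j$. $\mu_k^*:\mathcal F^A(\mu_kt)\to\mathcal F^A(t)$ is $A'_i\mapsto A_i$ ($i\ne k$), $A'_k\mapsto A^{-\mathbf f_k+\sum_j[-b_{jk}]_+\mathbf f_j}+A^{-\mathbf f_k+\sum_j[b_{jk}]_+\mathbf f_j}$. For $\boldsymbol\mu=\mu_{k_l}\cdots\mu_{k_1}$: $\boldsymbol\mu^*=\mu_{k_1}^*\cdots\mu_{k_l}^*$. $\mathcal U^A(t)=\bigcap_{\boldsymbol\nu}\boldsymbol\nu^*\mathcal{LP}^A(\boldsymbol\nu t)\subset\mathcal F^A(t)$ over all mutation sequences; these are identified for different $t$ by mutations. Similar up to $\sigma$: $b_{ij}(t)=b_{\sigma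 i,\sigma j}(t')$, $d_i=d_{\sigma i}$ for $i,j\in I_{\mathrm{uf}}$. Twist endomorphisms. For $t'=\boldsymbol\mu t$ similar to $t$ up to $\sigma$, a (monomial) variation map is a $\Bbbk$-algebra homomorphism (for $*$) $\mathrm{var}^A_t:\mathcal{LP}^A(t)\to\mathcal{LP}^A(t')$ of the form $A^m\mapsto(A')^{\mathrm{var}^M_tm}$ for a linear map $\mathrm{var}^M_t:M^\circ(t)\to M^\circ(t')$ satisfying $\mathrm{var}^M_t(\mathbf f_k)\in\mathbf f'_{\sigma k}+M^\circ_{\mathrm f}(t')$, $\mathrm{var}^M_t(\mathbf f_j)\in M^\circ_{\mathrm f}(t')$, $\mathrm{var}^M_t(p^*\mathbf e_k)=p^*\mathbf e'_{\sigma k}$ for $k\in I_{\mathrm{uf}}$, $j\in I_{\mathrm f}$. It restricts to $\mathcal U^A(t)\to\mathcal U^A(t')$. A twist endomorphism on $\mathcal U^A(t)$ is a composition $\boldsymbol\mu^*\circ\mathrm{var}^A_t$ for some such $t'=\boldsymbol\mu t$, $\sigma$, $\mathrm{var}^A_t$; it is a twist automorphism if $\mathrm{var}^A_t$ is invertible. *)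

theory Defs
  imports
    "HOL-Library.Poly_Mapping"
    "HOL-Analysis.Finite_Cartesian_Product"
    "HOL-Algebra.Ring"
    "HOL-Combinatorics.Permutations"
begin

section \<open>Base ring\<close>

text \<open>
  The type \<open>laurent\<close> is the group ring of the rationals, i.e. integral combinations of the
  powers \<open>v\<^sup>q\<close> with \<open>q\<close> rational. The base ring is a subring of it: the
  integers in the classical case, and the Laurent polynomials in \<open>v\<close> to the power \<open>1/d'\<close> in
  the quantum case.
\<close>

type_synonym laurent = "rat \<Rightarrow>\<^sub>0 int"

datatype base = Classical | Quantum nat

fun base_ring :: "base \<Rightarrow> laurent set" where
  "base_ring Classical = {c. Poly_Mapping.keys c \<subseteq> {0}}"
| "base_ring (Quantum d') = {c. \<forall>q \<in> Poly_Mapping.keys c. of_nat d' * q \<in> \<int>}"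

definition vpow :: "rat \<Rightarrow> laurent" where
  "vpow q = Poly_Mapping.single q 1"

section \<open>Seeds\<close>

text \<open>
  The index set \<open>I\<close> is the type \<open>'i\<close>; its unfrozen part is a set \<open>Iuf\<close>, and the frozen part
  is the complement. The lattices \<open>N(t)\<close> and \<open>M\<degree>(t)\<close> are written as \<open>int ^ 'i\<close>
  by means of the bases \<open>e\<^sub>i\<close> and \<open>f\<^sub>i\<close>. The entry \<open>b\<^sub>i\<^sub>j\<close> is
  \<open>bmat t $ i $ j\<close>, and \<open>lam t $ i $ j\<close> is the value of \<open>\<lambda>\<close> on
  \<open>(f\<^sub>i, f\<^sub>j)\<close>. In the classical case there is no Poisson structure and \<open>lam\<close> is \<open>0\<close>,
  which makes the twisted product below the usual one.

  The field \<open>addr\<close> names the tuple of indeterminates of the seed: it is the reduced mutation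
  word that leads from the initial seed to the seed (the most recent mutation first), i.e. a
  vertex of the regular tree that carries the seed pattern. Hence seeds with the same matrix but
  different indeterminates are different, and mutating twice in a row in the same direction
  gives back the original seed.
\<close>

record 'i seed =
  bmat :: "int ^ 'i ^ 'i"
  lam :: "rat ^ 'i ^ 'i"
  addr :: "'i list"

definition pos_part :: "int \<Rightarrow> int" where
  "pos_part x = max x 0"

definition form :: "rat ^ 'i ^ 'i \<Rightarrow> int ^ 'i \<Rightarrow> int ^ 'i::finite \<Rightarrow> rat" where
  "form L m m' = (\<Sum>i\<in>UNIV. \<Sum>j\<in>UNIV. of_int (m $ i) * of_int (m' $ j) * L $ i $ j)"

definition pstar :: "'i::finite seed \<Rightarrow> int ^ 'i \<Rightarrow> int ^ 'i" where
  "pstar t n = bmat t *v n"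

definition M_frozen :: "'i set \<Rightarrow> (int ^ 'i) set" where
  "M_frozen Iuf = {u. \<forall>k\<in>Iuf. u $ k = 0}"

definition compatible_poisson :: "'i set \<Rightarrow> ('i \<Rightarrow> int) \<Rightarrow> 'i::finite seed \<Rightarrow> bool" where
  "compatible_poisson Iuf d t \<longleftrightarrow>
     (\<forall>m m'. form (lam t) m m' = - form (lam t) m' m) \<and>
     (\<forall>i. \<forall>k\<in>Iuf. form (lam t) (axis i 1) (pstar t (axis k 1)) =
        (if i = k then - (1 / of_int (d k)) else 0))"

text \<open>In the quantum case the last conjunct says that \<open>d'\<close> is sufficiently divisible: all
  powers \<open>v\<^bsup>\<lambda>(m,m')\<^esup>\<close> lie in the base ring.\<close>

definition initial_seed ::
  "'i set \<Rightarrow> ('i \<Rightarrow> int) \<Rightarrow> base \<Rightarrow> 'i::finite seed \<Rightarrow> bool" where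
  "initial_seed Iuf d bs t \<longleftrightarrow>
     addr t = [] \<and>
     (\<forall>i j. (1 / of_int (d i)) * of_int (bmat t $ i $ j) =
        - ((1 / of_int (d j)) * (of_int (bmat t $ j $ i) :: rat))) \<and>
     (case bs of
        Classical \<Rightarrow> lam t = 0
      | Quantum d' \<Rightarrow> d' > 0 \<and> compatible_poisson Iuf d t \<and>
          (\<forall>i j. of_nat d' * lam t $ i $ j \<in> \<int>))"

section \<open>Mutation of seeds\<close>

definition exch_minus :: "'i \<Rightarrow> 'i::finite seed \<Rightarrow> int ^ 'i" where
  "exch_minus k t = - axis k 1 + (\<chi> j. pos_part (- bmat t $ j $ k))"

definition exch_plus :: "'i \<Rightarrow> 'i::finite seed \<Rightarrow> int ^ 'i" where
  "exch_plus k t = - axis k 1 + (\<chi> j. pos_part (bmat t $ j $ k))"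

text \<open>The image in \<open>M\<degree>(t)\<close> of the \<open>i\<close>-th basis vector of the mutated lattice.\<close>

definition basis_image :: "'i \<Rightarrow> 'i::finite seed \<Rightarrow> 'i \<Rightarrow> int ^ 'i" where
  "basis_image k t i = (if i = k then exch_minus k t else axis i 1)"

definition mutate :: "'i \<Rightarrow> 'i::finite seed \<Rightarrow> 'i seed" where
  "mutate k t =
     \<lparr> bmat = (\<chi> i j. if k = i \<or> k = j then - bmat t $ i $ j
          else bmat t $ i $ j + bmat t $ i $ k * pos_part (bmat t $ k $ j)
               + pos_part (- bmat t $ i $ k) * bmat t $ k $ j),
       lam = (\<chi> i j. form (lam t) (basis_image k t i) (basis_image k t j)),
       addr = (case addr t of [] \<Rightarrow> [k] | l # w \<Rightarrow> if l = k then w else k # l # w) \<rparr>"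

text \<open>A list \<open>[k\<^sub>1, \<dots>, k\<^sub>l]\<close> stands for the sequence that applies the mutation in direction
  \<open>k\<^sub>1\<close> first.\<close>

definition mutates :: "'i list \<Rightarrow> 'i::finite seed \<Rightarrow> 'i seed" where
  "mutates ks t = fold mutate ks t"

definition Delta :: "'i set \<Rightarrow> 'i::finite seed \<Rightarrow> 'i seed set" where
  "Delta Iuf t0 = {mutates ks t0 | ks. ks \<in> lists Iuf}"

section \<open>Quantum torus and skew-field of fractions\<close>

text \<open>The multiplication of the type \<open>'i lp\<close> is the commutative product; the twisted product
  is \<open>qmult\<close>.\<close>

type_synonym 'i lp = "(int ^ 'i) \<Rightarrow>\<^sub>0 laurent"

definition Amon :: "int ^ 'i \<Rightarrow> 'i lp" where
  "Amon m = Poly_Mapping.single m 1"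

definition scal :: "laurent \<Rightarrow> 'i::finite lp" where
  "scal c = Poly_Mapping.single 0 c"

definition qmult :: "rat ^ 'i ^ 'i \<Rightarrow> 'i::finite lp \<Rightarrow> 'i lp \<Rightarrow> 'i lp" where
  "qmult L f g =
     (\<Sum>m\<in>Poly_Mapping.keys f. \<Sum>m'\<in>Poly_Mapping.keys g.
        Poly_Mapping.single (m + m')
          (Poly_Mapping.lookup f m * Poly_Mapping.lookup g m' * vpow (form L m m')))"

definition LP :: "base \<Rightarrow> 'i::finite seed \<Rightarrow> 'i lp ring" where
  "LP bs t =
     \<lparr> carrier = {f. \<forall>m. Poly_Mapping.lookup f m \<in> base_ring bs},
       monoid.mult = qmult (lam t), one = 1, zero = 0, add = (+) \<rparr>"

definition skew_field_of_fractions :: "'a ring \<Rightarrow> 'f ring \<Rightarrow> ('a \<Rightarrow> 'f) \<Rightarrow> bool" where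
  "skew_field_of_fractions R K \<iota> \<longleftrightarrow>
     ring K \<and> Units K = carrier K - {\<zero>\<^bsub>K\<^esub>} \<and>
     \<iota> \<in> ring_hom R K \<and> inj_on \<iota> (carrier R) \<and>
     carrier K = {\<iota> a \<otimes>\<^bsub>K\<^esub> inv\<^bsub>K\<^esub> (\<iota> s) | a s. a \<in> carrier R \<and> s \<in> carrier R - {\<zero>\<^bsub>R\<^esub>}}"

text \<open>Homomorphisms of algebras over the base ring; \<open>\<eta>\<close> and \<open>\<theta>\<close> are the structure maps of
  \<open>R\<close> and \<open>S\<close>.\<close>

definition alg_hom ::
  "base \<Rightarrow> 'a ring \<Rightarrow> (laurent \<Rightarrow> 'a) \<Rightarrow> 'b ring \<Rightarrow> (laurent \<Rightarrow> 'b) \<Rightarrow> ('a \<Rightarrow> 'b) \<Rightarrow> bool" where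
  "alg_hom bs R \<eta> S \<theta> \<phi> \<longleftrightarrow> \<phi> \<in> ring_hom R S \<and> (\<forall>c\<in>base_ring bs. \<phi> (\<eta> c) = \<theta> c)"

section \<open>Mutation maps and upper cluster algebras\<close>

text \<open>From here on, \<open>K t\<close> is the skew-field of fractions of \<open>LP bs t\<close>, with the embedding
  \<open>\<iota> t\<close> of \<open>LP bs t\<close>. Mutation maps are extensional on \<open>carrier (K (mutate k t))\<close>, so that they
  are determined by the images of the generators.\<close>

definition is_mutation_map ::
  "base \<Rightarrow> ('i::finite seed \<Rightarrow> 'f ring) \<Rightarrow> ('i seed \<Rightarrow> 'i lp \<Rightarrow> 'f) \<Rightarrow>
     'i \<Rightarrow> 'i seed \<Rightarrow> ('f \<Rightarrow> 'f) \<Rightarrow> bool" where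
  "is_mutation_map bs K \<iota> k t \<phi> \<longleftrightarrow>
     (let t' = mutate k t in
        \<phi> \<in> extensional (carrier (K t')) \<and>
        alg_hom bs (K t') (\<iota> t' \<circ> scal) (K t) (\<iota> t \<circ> scal) \<phi> \<and>
        (\<forall>i. i \<noteq> k \<longrightarrow> \<phi> (\<iota> t' (Amon (axis i 1))) = \<iota> t (Amon (axis i 1))) \<and>
        \<phi> (\<iota> t' (Amon (axis k 1))) = \<iota> t (Amon (exch_minus k t) + Amon (exch_plus k t)))"

definition mutation_map ::
  "base \<Rightarrow> ('i::finite seed \<Rightarrow> 'f ring) \<Rightarrow> ('i seed \<Rightarrow> 'i lp \<Rightarrow> 'f) \<Rightarrow>
     'i \<Rightarrow> 'i seed \<Rightarrow> 'f \<Rightarrow> 'f" where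
  "mutation_map bs K \<iota> k t = (THE \<phi>. is_mutation_map bs K \<iota> k t \<phi>)"

fun mutations_map ::
  "base \<Rightarrow> ('i::finite seed \<Rightarrow> 'f ring) \<Rightarrow> ('i seed \<Rightarrow> 'i lp \<Rightarrow> 'f) \<Rightarrow>
     'i list \<Rightarrow> 'i seed \<Rightarrow> 'f \<Rightarrow> 'f" where
  "mutations_map bs K \<iota> [] t = id"
| "mutations_map bs K \<iota> (k # ks) t =
     mutation_map bs K \<iota> k t \<circ> mutations_map bs K \<iota> ks (mutate k t)"

definition upper_cluster_algebra ::
  "'i::finite set \<Rightarrow> base \<Rightarrow> ('i seed \<Rightarrow> 'f ring) \<Rightarrow> ('i seed \<Rightarrow> 'i lp \<Rightarrow> 'f) \<Rightarrow>
     'i seed \<Rightarrow> 'f set" where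
  "upper_cluster_algebra Iuf bs K \<iota> t =
     (\<Inter>ks\<in>lists Iuf.
        mutations_map bs K \<iota> ks t ` \<iota> (mutates ks t) ` carrier (LP bs (mutates ks t)))"

section \<open>Twist endomorphisms\<close>

text \<open>Permutations of \<open>Iuf\<close> are extended by the identity to \<open>I\<close>, and vectors indexed by \<open>Iuf\<close>
  are extended by zero to \<open>I\<close>.\<close>

definition perm_vec :: "('i \<Rightarrow> 'i) \<Rightarrow> 'a ^ 'i \<Rightarrow> 'a ^ 'i" where
  "perm_vec \<sigma> w = (\<chi> i. w $ inv_into UNIV \<sigma> i)"

definition pr_uf :: "'i set \<Rightarrow> int ^ 'i \<Rightarrow> int ^ 'i" where
  "pr_uf Iuf w = (\<chi> i. if i \<in> Iuf then w $ i else 0)"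

definition similar ::
  "'i set \<Rightarrow> ('i \<Rightarrow> int) \<Rightarrow> ('i \<Rightarrow> 'i) \<Rightarrow> 'i::finite seed \<Rightarrow> 'i seed \<Rightarrow> bool" where
  "similar Iuf d \<sigma> t t' \<longleftrightarrow> \<sigma> permutes Iuf \<and>
     (\<forall>i\<in>Iuf. \<forall>j\<in>Iuf. bmat t $ i $ j = bmat t' $ \<sigma> i $ \<sigma> j) \<and> (\<forall>i\<in>Iuf. d i = d (\<sigma> i))"

definition variation_map ::
  "'i set \<Rightarrow> base \<Rightarrow> ('i \<Rightarrow> 'i) \<Rightarrow> 'i::finite seed \<Rightarrow> 'i seed \<Rightarrow> ('i lp \<Rightarrow> 'i lp) \<Rightarrow> bool" where
  "variation_map Iuf bs \<sigma> t t' var \<longleftrightarrow>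
     alg_hom bs (LP bs t) scal (LP bs t') scal var \<and>
     (\<exists>V :: int ^ 'i \<Rightarrow> int ^ 'i.
        (\<forall>x y. V (x + y) = V x + V y) \<and>
        (\<forall>m. var (Amon m) = Amon (V m)) \<and>
        (\<forall>k\<in>Iuf. V (axis k 1) - axis (\<sigma> k) 1 \<in> M_frozen Iuf) \<and>
        (\<forall>j. j \<notin> Iuf \<longrightarrow> V (axis j 1) \<in> M_frozen Iuf) \<and>
        (\<forall>k\<in>Iuf. V (pstar t (axis k 1)) = pstar t' (axis (\<sigma> k) 1)))"

text \<open>A twist is the composition of a variation map, regarded as a map from the image of
  \<open>LP bs t\<close> in \<open>K t\<close> to the image of \<open>LP bs t'\<close> in \<open>K t'\<close>, with the mutation map;
  as an endomorphism of the upper cluster algebra it is extensional on it.\<close>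

definition twist_map ::
  "'i::finite set \<Rightarrow> base \<Rightarrow> ('i seed \<Rightarrow> 'f ring) \<Rightarrow> ('i seed \<Rightarrow> 'i lp \<Rightarrow> 'f) \<Rightarrow>
     'i list \<Rightarrow> ('i lp \<Rightarrow> 'i lp) \<Rightarrow> 'i seed \<Rightarrow> 'f \<Rightarrow> 'f" where
  "twist_map Iuf bs K \<iota> ks var t =
     restrict
       (mutations_map bs K \<iota> ks t \<circ> \<iota> (mutates ks t) \<circ> var \<circ> the_inv_into (carrier (LP bs t)) (\<iota> t))
       (upper_cluster_algebra Iuf bs K \<iota> t)"

definition twist_endomorphism ::
  "'i::finite set \<Rightarrow> ('i \<Rightarrow> int) \<Rightarrow> base \<Rightarrow> ('i seed \<Rightarrow> 'f ring) \<Rightarrow> ('i seed \<Rightarrow> 'i lp \<Rightarrow> 'f) \<Rightarrow>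
     'i seed \<Rightarrow> ('f \<Rightarrow> 'f) \<Rightarrow> bool" where
  "twist_endomorphism Iuf d bs K \<iota> t tw \<longleftrightarrow>
     (\<exists>ks\<in>lists Iuf. \<exists>\<sigma> var.
        similar Iuf d \<sigma> t (mutates ks t) \<and>
        variation_map Iuf bs \<sigma> t (mutates ks t) var \<and>
        tw = twist_map Iuf bs K \<iota> ks var t)"

definition twist_automorphism ::
  "'i::finite set \<Rightarrow> ('i \<Rightarrow> int) \<Rightarrow> base \<Rightarrow> ('i seed \<Rightarrow> 'f ring) \<Rightarrow> ('i seed \<Rightarrow> 'i lp \<Rightarrow> 'f) \<Rightarrow>
     'i seed \<Rightarrow> ('f \<Rightarrow> 'f) \<Rightarrow> bool" where
  "twist_automorphism Iuf d bs K \<iota> t tw \<longleftrightarrow>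
     (\<exists>ks\<in>lists Iuf. \<exists>\<sigma> var.
        similar Iuf d \<sigma> t (mutates ks t) \<and>
        variation_map Iuf bs \<sigma> t (mutates ks t) var \<and>
        bij_betw var (carrier (LP bs t)) (carrier (LP bs (mutates ks t))) \<and>
        tw = twist_map Iuf bs K \<iota> ks var t)"

section \<open>The sets \<open>S(t)\<close>\<close>

text \<open>Polynomials in the \<open>X\<^sub>k\<close>, \<open>k\<close> unfrozen; exponents are extended by zero to all of \<open>I\<close>.\<close>

definition N_uf :: "'i set \<Rightarrow> (nat ^ 'i) set" where
  "N_uf Iuf = {n. \<forall>j. j \<notin> Iuf \<longrightarrow> n $ j = 0}"

definition F_polys :: "'i set \<Rightarrow> base \<Rightarrow> ((nat ^ 'i) \<Rightarrow>\<^sub>0 laurent) set" where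
  "F_polys Iuf bs =
     {F. Poly_Mapping.keys F \<subseteq> N_uf Iuf \<and> (\<forall>n. Poly_Mapping.lookup F n \<in> base_ring bs) \<and>
         Poly_Mapping.lookup F 0 = 1}"

definition subst_X :: "'i::finite seed \<Rightarrow> ((nat ^ 'i) \<Rightarrow>\<^sub>0 laurent) \<Rightarrow> 'i lp" where
  "subst_X t F =
     (\<Sum>n\<in>Poly_Mapping.keys F. scal (Poly_Mapping.lookup F n) * Amon (pstar t (\<chi> i. int (n $ i))))"

definition S_elem ::
  "('i::finite seed \<Rightarrow> int ^ 'i \<Rightarrow> ((nat ^ 'i) \<Rightarrow>\<^sub>0 laurent)) \<Rightarrow> 'i seed \<Rightarrow> int ^ 'i \<Rightarrow> 'i lp" where
  "S_elem F t m = Amon m * subst_X t (F t m)"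

definition S_set ::
  "('i::finite seed \<Rightarrow> 'i lp \<Rightarrow> 'f) \<Rightarrow> ('i seed \<Rightarrow> int ^ 'i \<Rightarrow> ((nat ^ 'i) \<Rightarrow>\<^sub>0 laurent)) \<Rightarrow>
     'i seed \<Rightarrow> 'f set" where
  "S_set \<iota> F t = {\<iota> t (S_elem F t m) | m. True}"

end

theory Submission
  imports Defs
begin

text \<open>
  The twist is the composition of a variation map \<open>var: LP(t) \<rightarrow> LP(t')\<close>, given on exponents by a
  linear map \<open>V\<close>, with the mutation map, which carries \<open>S(t')\<close> onto \<open>S(t)\<close>. Modulo frozen
  directions \<open>V\<close> acts by \<open>\<sigma>\<close>, and it sends \<open>p\<^sup>* n\<close> to \<open>p\<^sup>* (\<sigma> n)\<close>; as the coefficients of \<open>F\<^sub>m\<close>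
  depend only on the similarity class and on \<open>pr m\<close>, it follows that \<open>var\<close> sends \<open>S\<^sub>m(t)\<close> to
  \<open>S\<^sub>V\<^sub>m(t')\<close>. If \<open>var\<close> is invertible, then \<open>V\<close> is onto, because the exponents of \<open>var f\<close> all lie
  in the image of \<open>V\<close>.
\<close>

section \<open>Mutation sequences and reachable seeds\<close>

lemma mutates_append: "mutates (xs @ ys) t = mutates ys (mutates xs t)"
  by (simp add: mutates_def)

lemma mutates_in_Delta:
  assumes "t \<in> Delta Iuf t0" "ks \<in> lists Iuf"
  shows "mutates ks t \<in> Delta Iuf t0"
proof -
  obtain ls where "ls \<in> lists Iuf" "t = mutates ls t0"
    using assms(1) by (auto simp: Delta_def)
  then show ?thesis
    using assms(2) unfolding Delta_def
    by (auto simp: mutates_append intro!: exI[of _ "ls @ ks"])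
qed

section \<open>Permutation of coordinates by \<open>\<sigma>\<close>\<close>

lemma perm_vec_nth:
  assumes "\<sigma> permutes S"
  shows "perm_vec \<sigma> w $ \<sigma> i = w $ i"
  using permutes_inj[OF assms] by (simp add: perm_vec_def)

lemma inj_perm_vec:
  assumes "\<sigma> permutes S"
  shows "inj (perm_vec \<sigma>)"
  by (rule injI) (metis perm_vec_nth[OF assms] vec_eq_iff)

lemma perm_vec_surj_N_uf:
  assumes "\<sigma> permutes Iuf" "w \<in> N_uf Iuf"
  obtains n where "n \<in> N_uf Iuf" "w = perm_vec \<sigma> n"
proof
  show "(\<chi> i. w $ \<sigma> i) \<in> N_uf Iuf"
    using assms by (simp add: N_uf_def permutes_not_in)
  show "w = perm_vec \<sigma> (\<chi> i. w $ \<sigma> i)"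
    using assms(1) by (simp add: vec_eq_iff perm_vec_def permutes_inverses)
qed

section \<open>Additive maps on the lattices\<close>

lemma additive_vec_expansion:
  fixes V :: "int ^ 'i::finite \<Rightarrow> int ^ 'i"
  assumes add: "\<And>x y. V (x + y) = V x + V y"
  shows "V x = (\<Sum>j\<in>UNIV. x $ j *s V (axis j 1))"
proof -
  interpret additive V using add by unfold_locales
  \<comment> \<open>A variation map supplies an additive \<open>V\<close>. Repeated addition gives
    compatibility with natural multiples, and negation extends it to all integers.\<close>
  have nat_scale: "V (int n *s y) = int n *s V y" for n y
    by (induction n) (simp_all add: zero add vector_sadd_rdistrib)
  have scale: "V (c *s y) = c *s V y" for c y
  proof (cases c rule: int_cases2)
    case (nonneg n)
    then show ?thesis by (simp add: nat_scale)
  next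
    case (nonpos n)
    have neg: "(- int n) *s z = - (int n *s z)" for z :: "int ^ 'i"
      by (simp add: vec_eq_iff)
    show ?thesis using nonpos by (simp only: neg minus nat_scale)
  qed
  have "x = (\<Sum>j\<in>UNIV. x $ j *s axis j 1)"
    by (simp add: vec_eq_iff axis_def if_distrib cong: if_cong)
  then have "V x = V (\<Sum>j\<in>UNIV. x $ j *s axis j 1)" by simp
  also have "\<dots> = (\<Sum>j\<in>UNIV. x $ j *s V (axis j 1))"
    by (simp only: sum scale)
  finally show ?thesis .
qed

text \<open>This yields the condition on projections under which the coefficients of the
  F-polynomials are transferred from \<open>m\<close> to \<open>V m\<close>.\<close>

lemma pr_uf_additive_map:
  fixes V :: "int ^ 'i::finite \<Rightarrow> int ^ 'i"
  assumes perm: "\<sigma> permutes Iuf"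
    and add: "\<And>x y. V (x + y) = V x + V y"
    and unfrozen: "\<And>k. k \<in> Iuf \<Longrightarrow> V (axis k 1) - axis (\<sigma> k) 1 \<in> M_frozen Iuf"
    and frozen: "\<And>j. j \<notin> Iuf \<Longrightarrow> V (axis j 1) \<in> M_frozen Iuf"
  shows "pr_uf Iuf (V m) = perm_vec \<sigma> (pr_uf Iuf m)"
proof -
  have "pr_uf Iuf (V m) $ \<sigma> i = pr_uf Iuf m $ i" for i
  proof (cases "i \<in> Iuf")
    case True
    then have mem: "\<sigma> i \<in> Iuf" using perm by (simp add: permutes_in_image)
    \<comment> \<open>Membership in \<open>M_frozen\<close> only constrains unfrozen coordinates:
      the unfrozen rows of the matrix of \<open>V\<close> are those of the permutation matrix of
      \<open>\<sigma>\<close>.\<close>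
    have entry: "V (axis j 1) $ \<sigma> i = (if j = i then 1 else 0)" for j
    proof (cases "j \<in> Iuf")
      case True
      then show ?thesis
        using unfrozen[OF True] mem permutes_inj[OF perm]
        by (auto simp: M_frozen_def axis_def inj_eq)
    next
      case False
      then show ?thesis
        using frozen[OF False] mem \<open>i \<in> Iuf\<close> by (auto simp: M_frozen_def)
    qed
    have "V m $ \<sigma> i = (\<Sum>j\<in>UNIV. m $ j * V (axis j 1) $ \<sigma> i)"
      by (subst additive_vec_expansion[OF add]) simp
    also have "\<dots> = m $ i" by (simp add: entry if_distrib cong: if_cong)
    finally show ?thesis using True mem by (simp add: pr_uf_def)
  next
    case False
    then show ?thesis using perm by (simp add: pr_uf_def permutes_not_in)
  qed
  \<comment> \<open>Every index has the form \<open>\<sigma> i\<close>, so comparing these entries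
    suffices.\<close>
  then show ?thesis
    by (metis perm_vec_nth[OF perm] permutes_inverses(1)[OF perm] vec_eq_iff)
qed

lemma pstar_add: "pstar t (x + y) = pstar t x + pstar t y"
  by (simp add: pstar_def vec_eq_iff matrix_vector_mult_def algebra_simps sum.distrib)

lemma pstar_expansion: "pstar t x = (\<Sum>j\<in>UNIV. x $ j *s pstar t (axis j 1))"
  by (rule additive_vec_expansion[OF pstar_add])

lemma pstar_additive_map:
  fixes V :: "int ^ 'i::finite \<Rightarrow> int ^ 'i"
  assumes perm: "\<sigma> permutes Iuf"
    and add: "\<And>x y. V (x + y) = V x + V y"
    and star: "\<And>k. k \<in> Iuf \<Longrightarrow> V (pstar t (axis k 1)) = pstar t' (axis (\<sigma> k) 1)"
    and n: "\<And>j. j \<notin> Iuf \<Longrightarrow> n $ j = 0"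
  shows "V (pstar t n) = pstar t' (perm_vec \<sigma> n)"
proof -
  have "V (pstar t n) = (\<Sum>j\<in>UNIV. n $ j *s V (pstar t (axis j 1)))"
    by (rule additive_vec_expansion) (simp add: pstar_add add)
  also have "\<dots> = (\<Sum>j\<in>UNIV. n $ j *s pstar t' (axis (\<sigma> j) 1))"
  proof (rule sum.cong[OF refl])
    fix j
    show "n $ j *s V (pstar t (axis j 1)) = n $ j *s pstar t' (axis (\<sigma> j) 1)"
      by (cases "j \<in> Iuf") (simp_all add: star n)
  qed
  \<comment> \<open>Each summand becomes a function of \<open>\<sigma> j\<close>, so the sum can be
    reindexed along \<open>\<sigma>\<close>.\<close>
  also have "\<dots> = (\<Sum>j\<in>UNIV. perm_vec \<sigma> n $ \<sigma> j *s pstar t' (axis (\<sigma> j) 1))"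
    by (simp add: perm_vec_nth[OF perm])
  also have "\<dots> = (\<Sum>j\<in>UNIV. perm_vec \<sigma> n $ j *s pstar t' (axis j 1))"
    by (rule sum.reindex_bij_betw[OF permutes_bij[OF perm]])
  also have "\<dots> = pstar t' (perm_vec \<sigma> n)"
    by (rule pstar_expansion[symmetric])
  finally show ?thesis .
qed

section \<open>Monomials with coefficients under algebra homomorphisms\<close>

lemma base_ring_zero: "0 \<in> base_ring bs"
  by (cases bs) auto

lemma base_ring_one: "1 \<in> base_ring bs"
  by (cases bs) auto

lemma base_ring_add:
  assumes "a \<in> base_ring bs" "b \<in> base_ring bs"
  shows "a + b \<in> base_ring bs"
  using assms Poly_Mapping.keys_add[of a b] by (cases bs) auto

lemma carrier_LP_add:
  assumes "f \<in> carrier (LP bs t)" "g \<in> carrier (LP bs t)"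
  shows "f + g \<in> carrier (LP bs t)"
  using assms by (simp add: LP_def lookup_add base_ring_add)

lemma single_in_carrier_LP:
  assumes "c \<in> base_ring bs"
  shows "Poly_Mapping.single m c \<in> carrier (LP bs t)"
  using assms base_ring_zero by (simp add: LP_def lookup_single when_def)

lemma sum_single_in_carrier_LP:
  assumes "finite A" "\<And>a. a \<in> A \<Longrightarrow> c a \<in> base_ring bs"
  shows "(\<Sum>a\<in>A. Poly_Mapping.single (g a) (c a)) \<in> carrier (LP bs t)"
  using assms
proof (induction A rule: finite_induct)
  case empty
  then show ?case by (simp add: LP_def base_ring_zero)
next
  case (insert x A)
  then show ?case by (simp add: carrier_LP_add single_in_carrier_LP)
qed

text \<open>The form vanishes when one argument is 0, so the twisting factor is 1. Thus a monomial
  with coefficient is a twisted product of two elements whose images under a variation map are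
  known.\<close>

lemma qmult_scal_Amon: "qmult L (scal c) (Amon m) = Poly_Mapping.single m c"
  by (cases "c = 0") (simp_all add: qmult_def scal_def Amon_def form_def vpow_def)

lemma alg_hom_single:
  assumes hom: "alg_hom bs (LP bs t) scal (LP bs t') scal \<phi>"
    and V: "\<And>m. \<phi> (Amon m) = Amon (V m)"
    and c: "c \<in> base_ring bs"
  shows "\<phi> (Poly_Mapping.single m c) = Poly_Mapping.single (V m) c"
proof -
  have "scal c \<in> carrier (LP bs t)" "Amon m \<in> carrier (LP bs t)"
    unfolding scal_def Amon_def using c base_ring_one by (blast intro: single_in_carrier_LP)+
  then have "\<phi> (qmult (lam t) (scal c) (Amon m)) = qmult (lam t') (\<phi> (scal c)) (\<phi> (Amon m))"
    using hom ring_hom_mult[of \<phi> "LP bs t" "LP bs t'" "scal c" "Amon m"]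
    by (simp add: alg_hom_def LP_def)
  also have "\<phi> (scal c) = scal c"
    using hom c by (simp add: alg_hom_def)
  finally show ?thesis by (simp add: V qmult_scal_Amon)
qed

text \<open>The sum runs over an index set and not over exponents, so \<open>g\<close> and
  \<open>V\<close> may identify exponents. This is needed since \<open>pstar\<close> need not be
  injective.\<close>

lemma alg_hom_sum_single:
  assumes hom: "alg_hom bs (LP bs t) scal (LP bs t') scal \<phi>"
    and V: "\<And>m. \<phi> (Amon m) = Amon (V m)"
    and "finite A" "\<And>a. a \<in> A \<Longrightarrow> c a \<in> base_ring bs"
  shows "\<phi> (\<Sum>a\<in>A. Poly_Mapping.single (g a) (c a)) =
    (\<Sum>a\<in>A. Poly_Mapping.single (V (g a)) (c a))"
  using assms(3,4)
proof (induction A rule: finite_induct)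
  case empty
  \<comment> \<open>A ring homomorphism is only given as respecting sums, products and one; its
    value at 0 is read off from the monomial with coefficient 0.\<close>
  have "\<phi> (Poly_Mapping.single 0 0) = Poly_Mapping.single (V 0) 0"
    by (rule alg_hom_single[OF hom V base_ring_zero])
  then show ?case by simp
next
  case (insert x A)
  let ?x = "Poly_Mapping.single (g x) (c x)"
  let ?A = "\<Sum>a\<in>A. Poly_Mapping.single (g a) (c a)"
  have "?x \<in> carrier (LP bs t)" "?A \<in> carrier (LP bs t)"
    using insert by (auto intro: single_in_carrier_LP sum_single_in_carrier_LP)
  then have "\<phi> (?x + ?A) = \<phi> ?x + \<phi> ?A"
    using ring_hom_add[of \<phi> "LP bs t" "LP bs t'" ?x ?A] hom
    by (simp add: alg_hom_def LP_def)
  then show ?case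
    using insert alg_hom_single[OF hom V] by simp
qed

lemma sum_single_lookup:
  "(\<Sum>m\<in>Poly_Mapping.keys f. Poly_Mapping.single m (Poly_Mapping.lookup f m)) = f"
  by (rule poly_mapping_eqI) (auto simp: lookup_sum lookup_single when_def in_keys_iff)

lemma alg_hom_monomial_surj:
  fixes V :: "int ^ 'i::finite \<Rightarrow> int ^ 'i"
  assumes hom: "alg_hom bs (LP bs t) scal (LP bs t') scal \<phi>"
    and V: "\<And>m. \<phi> (Amon m) = Amon (V m)"
    and surj: "\<phi> ` carrier (LP bs t) = carrier (LP bs t')"
  shows "surj V"
proof -
  have "\<exists>m. V m = m'" for m'
  proof -
    have "Amon m' \<in> carrier (LP bs t')"
      unfolding Amon_def by (rule single_in_carrier_LP[OF base_ring_one])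
    then obtain f where f: "f \<in> carrier (LP bs t)" "\<phi> f = Amon m'"
      using surj by force
    have "\<phi> f = \<phi> (\<Sum>m\<in>Poly_Mapping.keys f. Poly_Mapping.single m (Poly_Mapping.lookup f m))"
      by (simp add: sum_single_lookup)
    also have "\<dots> = (\<Sum>m\<in>Poly_Mapping.keys f.
        Poly_Mapping.single (V m) (Poly_Mapping.lookup f m))"
      using f(1) by (intro alg_hom_sum_single[OF hom V]) (auto simp: LP_def)
    \<comment> \<open>The coefficient of \<open>Amon m'\<close> at \<open>m'\<close> is 1, so some
      summand has exponent \<open>V m = m'\<close>.\<close>
    finally have "Poly_Mapping.lookup (\<Sum>m\<in>Poly_Mapping.keys f.
        Poly_Mapping.single (V m) (Poly_Mapping.lookup f m)) m' \<noteq> 0"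
      using f(2) by (metis Amon_def lookup_single_eq one_neq_zero)
    then show ?thesis
      by (auto simp: lookup_sum lookup_single when_def elim!: sum.not_neutral_contains_not_neutral
          split: if_splits)
  qed
  then show ?thesis by (metis surjI)
qed

section \<open>The elements \<open>S_elem\<close> under a variation map\<close>

lemma S_elem_eq_sum:
  "S_elem F t m = (\<Sum>n\<in>Poly_Mapping.keys (F t m).
     Poly_Mapping.single (m + pstar t (\<chi> i. int (n $ i))) (Poly_Mapping.lookup (F t m) n))"
  \<comment> \<open>The product here is the commutative one, so exponents add without a power of
    \<open>v\<close>.\<close>
  by (simp add: S_elem_def subst_X_def sum_distrib_left Amon_def scal_def mult_single)

lemma S_elem_in_carrier_LP:
  assumes "F t m \<in> F_polys Iuf bs"
  shows "S_elem F t m \<in> carrier (LP bs t)"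
  unfolding S_elem_eq_sum
  using assms by (intro sum_single_in_carrier_LP) (auto simp: F_polys_def)

text \<open>Coefficients are compared only on \<open>N_uf\<close>. This suffices because both
  supports lie there and each of its vectors is the permutation of another. It permits reindexing
  the sum for \<open>S_elem\<close>.\<close>

lemma keys_perm_vec:
  assumes perm: "\<sigma> permutes Iuf"
    and "Poly_Mapping.keys f \<subseteq> N_uf Iuf" "Poly_Mapping.keys g \<subseteq> N_uf Iuf"
    and coeff: "\<And>n. n \<in> N_uf Iuf \<Longrightarrow>
      Poly_Mapping.lookup g (perm_vec \<sigma> n) = Poly_Mapping.lookup f n"
  shows "Poly_Mapping.keys g = perm_vec \<sigma> ` Poly_Mapping.keys f"
proof
  show "Poly_Mapping.keys g \<subseteq> perm_vec \<sigma> ` Poly_Mapping.keys f"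
  proof
    fix w assume w: "w \<in> Poly_Mapping.keys g"
    then obtain n where "n \<in> N_uf Iuf" "w = perm_vec \<sigma> n"
      using assms(3) perm_vec_surj_N_uf[OF perm] by blast
    then show "w \<in> perm_vec \<sigma> ` Poly_Mapping.keys f"
      using w coeff by (auto simp: in_keys_iff)
  qed
  show "perm_vec \<sigma> ` Poly_Mapping.keys f \<subseteq> Poly_Mapping.keys g"
  proof (rule image_subsetI)
    fix n assume n: "n \<in> Poly_Mapping.keys f"
    then have "n \<in> N_uf Iuf" using assms(2) by blast
    from coeff[OF this] n show "perm_vec \<sigma> n \<in> Poly_Mapping.keys g"
      by (simp add: in_keys_iff)
  qed
qed

lemma variation_map_S_elem:
  assumes hom: "alg_hom bs (LP bs t) scal (LP bs t') scal \<phi>"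
    and V: "\<And>m. \<phi> (Amon m) = Amon (V m)"
    and perm: "\<sigma> permutes Iuf"
    and add: "\<And>x y. V (x + y) = V x + V y"
    and star: "\<And>k. k \<in> Iuf \<Longrightarrow> V (pstar t (axis k 1)) = pstar t' (axis (\<sigma> k) 1)"
    and F: "F t m \<in> F_polys Iuf bs" "F t' (V m) \<in> F_polys Iuf bs"
    and coeff: "\<And>n. n \<in> N_uf Iuf \<Longrightarrow>
      Poly_Mapping.lookup (F t' (V m)) (perm_vec \<sigma> n) = Poly_Mapping.lookup (F t m) n"
  shows "\<phi> (S_elem F t m) = S_elem F t' (V m)"
proof -
  have sub: "Poly_Mapping.keys (F t m) \<subseteq> N_uf Iuf" "Poly_Mapping.keys (F t' (V m)) \<subseteq> N_uf Iuf"
    using F by (auto simp: F_polys_def)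
  have "\<phi> (S_elem F t m) = (\<Sum>n\<in>Poly_Mapping.keys (F t m). Poly_Mapping.single
      (V (m + pstar t (\<chi> i. int (n $ i)))) (Poly_Mapping.lookup (F t m) n))"
    unfolding S_elem_eq_sum
    using F(1) by (intro alg_hom_sum_single[OF hom V]) (auto simp: F_polys_def)
  also have "\<dots> = (\<Sum>n\<in>Poly_Mapping.keys (F t m). Poly_Mapping.single
      (V m + pstar t' (\<chi> i. int (perm_vec \<sigma> n $ i)))
      (Poly_Mapping.lookup (F t' (V m)) (perm_vec \<sigma> n)))"
  proof (rule sum.cong[OF refl])
    fix n assume "n \<in> Poly_Mapping.keys (F t m)"
    then have n: "n \<in> N_uf Iuf" using sub by blast
    have "V (pstar t (\<chi> i. int (n $ i))) = pstar t' (perm_vec \<sigma> (\<chi> i. int (n $ i)))"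
      using n by (intro pstar_additive_map[OF perm add star]) (auto simp: N_uf_def)
    also have "perm_vec \<sigma> (\<chi> i. int (n $ i)) = (\<chi> i. int (perm_vec \<sigma> n $ i))"
      by (simp add: perm_vec_def)
    finally show "Poly_Mapping.single (V (m + pstar t (\<chi> i. int (n $ i))))
        (Poly_Mapping.lookup (F t m) n) =
      Poly_Mapping.single (V m + pstar t' (\<chi> i. int (perm_vec \<sigma> n $ i)))
        (Poly_Mapping.lookup (F t' (V m)) (perm_vec \<sigma> n))"
      by (simp add: add coeff[OF n])
  qed
  \<comment> \<open>Reindexing by the injective map \<open>perm_vec \<sigma>\<close>, which carries
    the support of \<open>F t m\<close> onto that of \<open>F t' (V m)\<close>.\<close>
  also have "\<dots> = S_elem F t' (V m)"
    unfolding S_elem_eq_sum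
    by (subst keys_perm_vec[OF perm sub coeff], assumption,
        subst sum.reindex[OF inj_on_subset[OF inj_perm_vec[OF perm] subset_UNIV]]) simp
  finally show ?thesis .
qed

section \<open>Twists acting on the sets \<open>S_set\<close>\<close>

theorem theorem6p2:
  fixes Iuf :: "'i::finite set"
    and d :: "'i \<Rightarrow> int"
    and bs :: base
    and t0 t :: "'i seed"
    and K :: "'i seed \<Rightarrow> 'f ring"
    and \<iota> :: "'i seed \<Rightarrow> 'i lp \<Rightarrow> 'f"
    and F :: "'i seed \<Rightarrow> int ^ 'i \<Rightarrow> ((nat ^ 'i) \<Rightarrow>\<^sub>0 laurent)"
    and tw :: "'f \<Rightarrow> 'f"
  assumes d_pos: "\<And>i. d i > 0"
    and init: "initial_seed Iuf d bs t0"
    and fractions: "\<And>s. s \<in> Delta Iuf t0 \<Longrightarrow> skew_field_of_fractions (LP bs s) (K s) (\<iota> s)"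
    and F_polys: "\<And>s m. s \<in> Delta Iuf t0 \<Longrightarrow> F s m \<in> F_polys Iuf bs"
    and mutation_invariant: "\<And>s s' ks. s \<in> Delta Iuf t0 \<Longrightarrow> s' \<in> Delta Iuf t0 \<Longrightarrow>
        ks \<in> lists Iuf \<Longrightarrow> s' = mutates ks s \<Longrightarrow>
        mutations_map bs K \<iota> ks s ` S_set \<iota> F s' = S_set \<iota> F s"
    and frozen_shift: "\<And>s m m' u. s \<in> Delta Iuf t0 \<Longrightarrow> u \<in> M_frozen Iuf \<Longrightarrow>
        m' = m + u \<Longrightarrow> F s m' = F s m"
    and similar_coeffs: "\<And>s s' \<sigma> m m' n. s \<in> Delta Iuf t0 \<Longrightarrow> s' \<in> Delta Iuf t0 \<Longrightarrow>
        similar Iuf d \<sigma> s s' \<Longrightarrow> pr_uf Iuf m' = perm_vec \<sigma> (pr_uf Iuf m) \<Longrightarrow>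
        n \<in> N_uf Iuf \<Longrightarrow>
        Poly_Mapping.lookup (F s' m') (perm_vec \<sigma> n) = Poly_Mapping.lookup (F s m) n"
    and t: "t \<in> Delta Iuf t0"
    and tw: "twist_endomorphism Iuf d bs K \<iota> t tw"
  shows "tw ` S_set \<iota> F t \<subseteq> S_set \<iota> F t \<and>
    (twist_automorphism Iuf d bs K \<iota> t tw \<longrightarrow> tw ` S_set \<iota> F t = S_set \<iota> F t)"
proof -
  have S_image: "S_set \<iota> F s \<subseteq> \<iota> s ` carrier (LP bs s)" if "s \<in> Delta Iuf t0" for s
    using F_polys[OF that] by (auto simp: S_set_def intro!: imageI S_elem_in_carrier_LP)
  \<comment> \<open>A twist is restricted to the upper cluster algebra, so its values on
    \<open>S_set\<close> are determined only after this inclusion. By invariance,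
    \<open>S_set\<close> is the mutation image of a set of Laurent polynomials at every reachable
    seed.\<close>
  have S_upper: "S_set \<iota> F t \<subseteq> upper_cluster_algebra Iuf bs K \<iota> t"
    unfolding upper_cluster_algebra_def
  proof (rule INT_greatest)
    fix ks assume ks: "ks \<in> lists Iuf"
    have "mutates ks t \<in> Delta Iuf t0" by (rule mutates_in_Delta[OF t ks])
    from mutation_invariant[OF t this ks refl] S_image[OF this]
    show "S_set \<iota> F t \<subseteq>
        mutations_map bs K \<iota> ks t ` \<iota> (mutates ks t) ` carrier (LP bs (mutates ks t))"
      by blast
  qed
  \<comment> \<open>Both claims are proved for arbitrary data, since the data witnessing that
    \<open>tw\<close> is an automorphism may differ from those witnessing that it is an
    endomorphism.\<close>
  have twist: "twist_map Iuf bs K \<iota> ks var t ` S_set \<iota> F t \<subseteq> S_set \<iota> F t \<and>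
      (bij_betw var (carrier (LP bs t)) (carrier (LP bs (mutates ks t))) \<longrightarrow>
        twist_map Iuf bs K \<iota> ks var t ` S_set \<iota> F t = S_set \<iota> F t)"
    if ks: "ks \<in> lists Iuf" and sim: "similar Iuf d \<sigma> t (mutates ks t)"
      and var: "variation_map Iuf bs \<sigma> t (mutates ks t) var" for ks \<sigma> var
  proof -
    define t' where "t' = mutates ks t"
    have t': "t' \<in> Delta Iuf t0"
      unfolding t'_def by (rule mutates_in_Delta[OF t ks])
    have perm: "\<sigma> permutes Iuf" using sim by (simp add: similar_def)
    obtain V where hom: "alg_hom bs (LP bs t) scal (LP bs t') scal var"
      and V: "\<And>m. var (Amon m) = Amon (V m)"
      and add: "\<And>x y. V (x + y) = V x + V y"
      and unfrozen: "\<And>k. k \<in> Iuf \<Longrightarrow> V (axis k 1) - axis (\<sigma> k) 1 \<in> M_frozen Iuf"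
      and frozen: "\<And>j. j \<notin> Iuf \<Longrightarrow> V (axis j 1) \<in> M_frozen Iuf"
      and star: "\<And>k. k \<in> Iuf \<Longrightarrow> V (pstar t (axis k 1)) = pstar t' (axis (\<sigma> k) 1)"
      using var unfolding variation_map_def t'_def by blast
    have pr: "pr_uf Iuf (V m) = perm_vec \<sigma> (pr_uf Iuf m)" for m
      by (rule pr_uf_additive_map[OF perm add unfrozen frozen])
    have var_S: "var (S_elem F t m) = S_elem F t' (V m)" for m
      using similar_coeffs[OF t t' sim[folded t'_def] pr]
      by (intro variation_map_S_elem[OF hom V perm add star F_polys[OF t] F_polys[OF t']])
    have inj: "inj_on (\<iota> t) (carrier (LP bs t))"
      using fractions[OF t] by (simp add: skew_field_of_fractions_def)
    \<comment> \<open>Injectivity of \<open>\<iota> t\<close> lets the inverse in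
      \<open>twist_map\<close> recover \<open>S_elem F t m\<close>.\<close>
    have tw_S: "twist_map Iuf bs K \<iota> ks var t (\<iota> t (S_elem F t m)) =
        mutations_map bs K \<iota> ks t (\<iota> t' (S_elem F t' (V m)))" for m
    proof -
      have "\<iota> t (S_elem F t m) \<in> upper_cluster_algebra Iuf bs K \<iota> t"
        using S_upper by (auto simp: S_set_def)
      then show ?thesis
        using the_inv_into_f_f[OF inj S_elem_in_carrier_LP[where F = F, OF F_polys[OF t]]]
        by (simp add: twist_map_def var_S flip: t'_def)
    qed
    have inv: "mutations_map bs K \<iota> ks t ` S_set \<iota> F t' = S_set \<iota> F t"
      by (rule mutation_invariant[OF t t' ks t'_def])
    \<comment> \<open>An equality is kept here: the index \<open>V m\<close> always gives elements
      of \<open>S_set \<iota> F t'\<close>, and exhausts them once \<open>V\<close> is onto.\<close>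
    have tw_image: "twist_map Iuf bs K \<iota> ks var t ` S_set \<iota> F t =
        mutations_map bs K \<iota> ks t ` {\<iota> t' (S_elem F t' (V m)) | m. True}"
      unfolding S_set_def by (auto simp: image_def tw_S)
    also have "\<dots> \<subseteq> mutations_map bs K \<iota> ks t ` S_set \<iota> F t'"
      by (rule image_mono) (auto simp: S_set_def)
    finally have "twist_map Iuf bs K \<iota> ks var t ` S_set \<iota> F t \<subseteq> S_set \<iota> F t"
      unfolding inv .
    moreover have "twist_map Iuf bs K \<iota> ks var t ` S_set \<iota> F t = S_set \<iota> F t"
      if "bij_betw var (carrier (LP bs t)) (carrier (LP bs (mutates ks t)))"
    proof -
      have "surj V"
        using that by (intro alg_hom_monomial_surj[OF hom V]) (simp add: bij_betw_def t'_def)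
      then have "{\<iota> t' (S_elem F t' (V m)) | m. True} = S_set \<iota> F t'"
        unfolding S_set_def by (auto, metis surjD)
      then show ?thesis by (simp only: tw_image inv)
    qed
    ultimately show ?thesis by blast
  qed
  show ?thesis
    using tw twist unfolding twist_endomorphism_def twist_automorphism_def by blast
qed

end
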